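(* For any choice of (constant) non-degenerate $\operatorname{ad}$-invariant metric $g$ on the subspace $M=\mathfrak g^*_{reg}$ of 4-dimensional co-adjoint orbits of the dual space $\mathfrak{se}(3)^*$ of the Lie algebra $\mathfrak g=\mathfrak{se}(3)$ of Euclidean motions of $\mathbf R^3$, the distribution $\mathcal N$ is integrable. For the metrics $$g=\begin{pmatrix}\alpha I&\beta I\\ \beta I&0\end{pmatrix}$$ with $\alpha=0$ (and $\beta\neq0$), the maximal integral submanifold passing through a point $(\mathbf x,\mathbf p)\in M$ is presented in parametric form as $$(s,t)\mapsto e^{s}\begin{pmatrix}\mathbf x^{T}\\ \mathbf p^{T}\end{pmatrix}+e^{t}\begin{pmatrix}\mathbf p^{T}\\ \mathbf 0\end{pmatrix}.$$
   Context: Elements of $\mathfrak g=\mathfrak{se}(3)$ are written as pairs $(\mathbf x,\mathbf p)\in\mathfrak{so}(3)\oplus\mathbf R^3\cong\mathbf R^3\oplus\mathbf R^3$ with bracket $[(\mathbf x,\mathbf p),(\mathbf x',\mathbf p')]=(\mathbf x\times\mathbf x',\ \mathbf x\times\mathbf p'+\mathbf p\times\mathbf x')$. The dual $\mathfrak g^*$ is identified with $\mathfrak g\cong\mathbf R^6$ via the Euclidean scalar product, and carries the linear Lie–Poisson structure, $\{f,h\}(m)=\langle m,[df_m,dh_m]\rangle$, whose symplectic leaves are the co-adjoint orbits. Its Casimir functions are $c_1=\mathbf x\cdot\mathbf p$ and $c_2=\mathbf p\cdot\mathbf p$, and $M=\mathfrak g^*_{reg}=\{(\mathbf x,\mathbf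 p):\mathbf p\cdot\mathbf p\ne0\}$ is the union of the 4-dimensional co-adjoint orbits. A constant metric $g$ is given by a constant symmetric non-degenerate bilinear form on $\mathfrak g$, regarded as a symmetric $(2,0)$-tensor on $M$ (i.e. a form on the cotangent spaces $T^*_mM\cong\mathfrak g$); it is $\operatorname{ad}$-invariant if $\langle\operatorname{ad}_{Z}X,Y\rangle_g+\langle X,\operatorname{ad}_{Z}Y\rangle_g=0$ for all $X,Y,Z\in\mathfrak g$. In the block matrix form of $g$, the blocks are $3\times3$, $I$ is the identity matrix, $\alpha,\beta$ are real constants, and $\langle(\mathbf x,\mathbf p),(\mathbf x',\mathbf p')\rangle_g=(\mathbf x,\mathbf p)\,g\,(\mathbf x',\mathbf p')^T$. $\mathcal N$ is the distribution on $M$ that is orthogonal, with respect to the metric $g^{-1}$ on tangent spaces, to the tangent spaces of the symplectic leaves; $s,t$ are real parameters. A distribution is integrable iff it is involutive (Frobenius).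
   Formalization: The printed map with e^t never reaches (x,p); the maximal integral submanifold is proved to be parametrized by e^s(x,p)+t(p,0), t real, and the printed map to parametrize only its open part where the coefficient of (p,0) is positive. *)

theory Defs
  imports "HOL-Analysis.Analysis"
begin

section \<open>Smooth maps, integral submanifolds and integrable distributions\<close>

text \<open>Meant for open \<open>S\<close>. Since all directional derivatives are required to be of
  class \<open>C\<^sup>k\<close>, this is the usual notion on finite-dimensional spaces.\<close>

primrec Ck_on :: "nat \<Rightarrow> 'a::euclidean_space set \<Rightarrow> ('a \<Rightarrow> 'b::real_normed_vector) \<Rightarrow> bool" where
  "Ck_on 0 S f \<longleftrightarrow> continuous_on S f"
| "Ck_on (Suc k) S f \<longleftrightarrow>
     (\<forall>x\<in>S. f differentiable (at x)) \<and> (\<forall>v. Ck_on k S (\<lambda>x. frechet_derivative f (at x) v))"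

definition smooth_on :: "'a::euclidean_space set \<Rightarrow> ('a \<Rightarrow> 'b::real_normed_vector) \<Rightarrow> bool" where
  "smooth_on S f \<longleftrightarrow> (\<forall>k. Ck_on k S f)"

text \<open>A distribution \<open>D\<close> assigns to each point \<open>q\<close> of an open set \<open>M\<close> a set \<open>D q\<close> of tangent
  vectors. Everything below is for distributions of rank 2.\<close>

definition smooth_distribution2 :: "'a::euclidean_space set \<Rightarrow> ('a \<Rightarrow> 'a set) \<Rightarrow> bool" where
  "smooth_distribution2 M D \<longleftrightarrow>
     (\<forall>m\<in>M. \<exists>U X Y. open U \<and> m \<in> U \<and> U \<subseteq> M \<and> smooth_on U X \<and> smooth_on U Y \<and>
        (\<forall>q\<in>U. dim (D q) = 2 \<and> D q = span {X q, Y q}))"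

definition integral_immersion ::
  "('a::euclidean_space \<Rightarrow> 'a set) \<Rightarrow> (real \<times> real) set \<Rightarrow> (real \<times> real \<Rightarrow> 'a) \<Rightarrow> bool" where
  "integral_immersion D U \<phi> \<longleftrightarrow> smooth_on U \<phi> \<and>
     (\<forall>u\<in>U. inj (frechet_derivative \<phi> (at u)) \<and> range (frechet_derivative \<phi> (at u)) = D (\<phi> u))"

text \<open>An immersed submanifold is encoded by its manifold topology \<open>T\<close>, which need not be the
  subspace topology of \<open>topspace T\<close>. The smooth structure need not be given separately: changes
  of charts are homeomorphisms between open subsets of the plane, and they are smooth because the
  charts are immersions into the ambient space.\<close>

definition integral_submanifold ::
  "'a::euclidean_space set \<Rightarrow> ('a \<Rightarrow> 'a set) \<Rightarrow> 'a topology \<Rightarrow> bool" where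
  "integral_submanifold M D T \<longleftrightarrow>
     topspace T \<subseteq> M \<and> Hausdorff_space T \<and> second_countable T \<and>
     (\<forall>q\<in>topspace T. \<exists>U V \<phi>. open U \<and> openin T V \<and> q \<in> V \<and>
        homeomorphic_map (top_of_set U) (subtopology T V) \<phi> \<and> integral_immersion D U \<phi>)"

definition integrable_distribution2 :: "'a::euclidean_space set \<Rightarrow> ('a \<Rightarrow> 'a set) \<Rightarrow> bool" where
  "integrable_distribution2 M D \<longleftrightarrow> smooth_distribution2 M D \<and>
     (\<forall>m\<in>M. \<exists>T. integral_submanifold M D T \<and> m \<in> topspace T)"

definition maximal_integral_submanifold ::
  "'a::euclidean_space set \<Rightarrow> ('a \<Rightarrow> 'a set) \<Rightarrow> 'a set \<Rightarrow> bool" where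
  "maximal_integral_submanifold M D L \<longleftrightarrow>
     (\<exists>T. integral_submanifold M D T \<and> connected_space T \<and> topspace T = L) \<and>
     (\<forall>T. integral_submanifold M D T \<and> connected_space T \<and> L \<subseteq> topspace T \<longrightarrow> topspace T = L)"

definition parametrizes ::
  "('a::euclidean_space \<Rightarrow> 'a set) \<Rightarrow> (real \<times> real \<Rightarrow> 'a) \<Rightarrow> 'a set \<Rightarrow> bool" where
  "parametrizes D \<phi> S \<longleftrightarrow> integral_immersion D UNIV \<phi> \<and> inj \<phi> \<and> range \<phi> = S"


section \<open>The Lie algebra \<open>se(3)\<close> and the Lie--Poisson structure of its dual\<close>

text \<open>The dual of \<open>se(3)\<close> is identified with \<open>se(3)\<close> by the inner product, so that points
  of the dual, tangent vectors and covectors all have type \<open>se3\<close>.\<close>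

type_synonym se3 = "(real^3) \<times> (real^3)"

definition se3_bracket :: "se3 \<Rightarrow> se3 \<Rightarrow> se3" where
  "se3_bracket X Y = (cross3 (fst X) (fst Y), cross3 (fst X) (snd Y) + cross3 (snd X) (fst Y))"

definition se3_reg :: "se3 set" where
  "se3_reg = {(x, p). p \<bullet> p \<noteq> 0}"

definition gradient :: "(se3 \<Rightarrow> real) \<Rightarrow> se3 \<Rightarrow> se3" where
  "gradient f m = (THE D. GDERIV f m :> D)"

definition poisson_bracket :: "(se3 \<Rightarrow> real) \<Rightarrow> (se3 \<Rightarrow> real) \<Rightarrow> se3 \<Rightarrow> real" where
  "poisson_bracket f h m = m \<bullet> se3_bracket (gradient f m) (gradient h m)"

text \<open>Integral curves over the unit interval of the Hamiltonian vector field of \<open>f\<close>, in the form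
  \<open>d/dt h(\<gamma> t) = {h, f}(\<gamma> t)\<close> for all observables \<open>h\<close>.\<close>

definition hamiltonian_curve :: "(se3 \<Rightarrow> real) \<Rightarrow> (real \<Rightarrow> se3) \<Rightarrow> bool" where
  "hamiltonian_curve f \<gamma> \<longleftrightarrow> \<gamma> ` {0..1} \<subseteq> se3_reg \<and>
     (\<forall>h. smooth_on se3_reg h \<longrightarrow>
        (\<forall>t\<in>{0..1}. ((\<lambda>s. h (\<gamma> s)) has_real_derivative poisson_bracket h f (\<gamma> t)) (at t within {0..1})))"

definition hamiltonian_step :: "se3 \<Rightarrow> se3 \<Rightarrow> bool" where
  "hamiltonian_step m m' \<longleftrightarrow>
     (\<exists>f \<gamma>. smooth_on se3_reg f \<and> hamiltonian_curve f \<gamma> \<and> \<gamma> 0 = m \<and> \<gamma> 1 = m')"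

text \<open>The symplectic leaf of \<open>m\<close> (here a co-adjoint orbit) consists of the points that can be reached
  from \<open>m\<close> along finitely many Hamiltonian curves.\<close>

definition symplectic_leaf :: "se3 \<Rightarrow> se3 set" where
  "symplectic_leaf m = {m'. hamiltonian_step\<^sup>*\<^sup>* m m'}"

text \<open>Velocities of curves in \<open>S\<close>. This is the tangent space of \<open>S\<close> if \<open>S\<close> is an embedded submanifold,
  as the leaves in \<open>se3_reg\<close> are: they lie on common level sets of \<open>x \<bullet> p\<close> and \<open>p \<bullet> p\<close>, of the
  same dimension 4.\<close>

definition tangent_space :: "'a::euclidean_space set \<Rightarrow> 'a \<Rightarrow> 'a set" where
  "tangent_space S m = {v. \<exists>\<gamma>. \<gamma> C1_differentiable_on {-1<..<1} \<and> \<gamma> ` {-1<..<1} \<subseteq> S \<and> \<gamma> 0 = m \<and>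
                             (\<gamma> has_vector_derivative v) (at 0)}"


section \<open>Constant metrics\<close>

definition constant_metric :: "(se3 \<Rightarrow> se3 \<Rightarrow> real) \<Rightarrow> bool" where
  "constant_metric g \<longleftrightarrow> bilinear g \<and> (\<forall>X Y. g X Y = g Y X) \<and> (\<forall>X. (\<forall>Y. g X Y = 0) \<longrightarrow> X = 0)"

definition ad_invariant :: "(se3 \<Rightarrow> se3 \<Rightarrow> real) \<Rightarrow> bool" where
  "ad_invariant g \<longleftrightarrow> (\<forall>X Y Z. g (se3_bracket Z X) Y + g X (se3_bracket Z Y) = 0)"

text \<open>The form \<open>(x,p) g (x',p')\<^sup>T\<close> of the block matrix \<open>g\<close> with rows \<open>(A, B)\<close> and \<open>(C, D)\<close>.\<close>

definition block_form ::
  "real^3^3 \<Rightarrow> real^3^3 \<Rightarrow> real^3^3 \<Rightarrow> real^3^3 \<Rightarrow> se3 \<Rightarrow> se3 \<Rightarrow> real" where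
  "block_form A B C D X Y =
     fst X \<bullet> (A *v fst Y) + fst X \<bullet> (B *v snd Y) + snd X \<bullet> (C *v fst Y) + snd X \<bullet> (D *v snd Y)"

text \<open>A metric \<open>g\<close> is a form on covectors. It induces a map from covectors to tangent vectors (the
  matrix \<open>g\<close>), by whose inverse it is carried over to the form with the inverse matrix on tangent
  vectors.\<close>

definition metric_map :: "(se3 \<Rightarrow> se3 \<Rightarrow> real) \<Rightarrow> se3 \<Rightarrow> se3" where
  "metric_map g X = (THE v. \<forall>Y. v \<bullet> Y = g X Y)"

definition inverse_metric :: "(se3 \<Rightarrow> se3 \<Rightarrow> real) \<Rightarrow> se3 \<Rightarrow> se3 \<Rightarrow> real" where
  "inverse_metric g v w = g (inv (metric_map g) v) (inv (metric_map g) w)"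

definition normal_distribution :: "(se3 \<Rightarrow> se3 \<Rightarrow> real) \<Rightarrow> se3 \<Rightarrow> se3 set" where
  "normal_distribution g m =
     {v. \<forall>w\<in>tangent_space (symplectic_leaf m) m. inverse_metric g v w = 0}"

lemma block_form_metric:
  fixes \<alpha> \<beta> :: real
  assumes "\<beta> \<noteq> 0"
  defines "g \<equiv> block_form (\<alpha> *\<^sub>R mat 1) (\<beta> *\<^sub>R mat 1) (\<beta> *\<^sub>R mat 1) 0"
  shows "constant_metric g" and "ad_invariant g"
proof -
  have g: "g X Y = \<alpha> * (fst X \<bullet> fst Y) + \<beta> * (fst X \<bullet> snd Y) + \<beta> * (snd X \<bullet> fst Y)" for X Y
    by (simp add: g_def block_form_def flip: scaleR_matrix_vector_assoc)
  have "X = 0" if "\<forall>Y. g X Y = 0" for X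
  proof -
    have "g X (0, fst X) = 0" "g X (snd X, 0) = 0" using that by auto
    then have "fst X = 0" "snd X = 0" using assms(1) by (auto simp: g)
    then show ?thesis by (simp add: prod_eq_iff)
  qed
  then show "constant_metric g"
    unfolding constant_metric_def bilinear_def linear_iff
    by (auto simp: g inner_commute inner_add_left inner_add_right algebra_simps)
  show "ad_invariant g"
    unfolding ad_invariant_def by (simp add: g se3_bracket_def cross3_simps)
qed

end

theory Submission
  imports Defs
begin

text \<open>
  An \<open>ad\<close>-invariant form is \<open>\<alpha> (x \<bullet> x') + \<beta> (x \<bullet> p' + p \<bullet> x')\<close> with \<open>\<beta> \<noteq> 0\<close>. The normal space
  at \<open>(x, p)\<close> is the image under \<open>g\<close> of the span of the differentials \<open>(p, x)\<close> and \<open>(0, 2 p)\<close> of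
  the Casimirs, that is, the span of \<open>(x, p)\<close> and \<open>(p, 0)\<close>, whatever \<open>\<alpha>\<close> and \<open>\<beta>\<close> are. These two
  commuting linear vector fields have the explicit joint flow \<open>(s, t) \<mapsto> e\<^sup>s (x, p) + t (p, 0)\<close>,
  whose orbits are the fibres of a map with derivative vanishing on the distribution. That map is
  constant on every connected integral submanifold, which gives maximality and uniqueness without
  the Frobenius theorem.
\<close>

section \<open>Smooth maps\<close>

lemma Ck_on_const: "Ck_on k S (\<lambda>_. c)"
  by (induction k arbitrary: c) (auto simp: frechet_derivative_const)

text \<open>The directional derivative along \<open>v\<close> is \<open>f v\<close> at every base
  point, so from order one on only constant maps occur.\<close>

lemma smooth_on_bounded_linear:
  assumes "bounded_linear f"
  shows "smooth_on S f"
proof -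
  have "frechet_derivative f (at x) = f" for x
    using bounded_linear_imp_has_derivative[OF assms] by (metis frechet_derivative_at)
  then have "Ck_on k S f" for k
    using assms
    by (cases k) (auto simp: Ck_on_const linear_continuous_on bounded_linear_imp_differentiable)
  then show ?thesis by (simp add: smooth_on_def)
qed

lemma smooth_on_SucI:
  assumes "\<And>x. x \<in> S \<Longrightarrow> f differentiable (at x)"
    and "\<And>v. smooth_on S (\<lambda>x. frechet_derivative f (at x) v)"
  shows "smooth_on S f"
  unfolding smooth_on_def
proof
  fix k show "Ck_on k S f"
  proof (cases k)
    case 0
    then show ?thesis
      using assms(1) by (auto intro!: continuous_at_imp_continuous_on differentiable_imp_continuous_within)
  next
    case (Suc k)
    then show ?thesis using assms by (auto simp: smooth_on_def)
  qed
qed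

text \<open>Each directional derivative is again linear in \<open>x\<close>, so the linear case
  finishes after one step. It is meant for the two quadratic Casimirs.\<close>

lemma smooth_on_bilinear:
  assumes "bounded_bilinear B" "bounded_linear f" "bounded_linear g"
  shows "smooth_on S (\<lambda>x. B (f x) (g x))"
proof -
  interpret bounded_bilinear B by fact
  have D: "((\<lambda>x. B (f x) (g x)) has_derivative (\<lambda>v. B (f x) (g v) + B (f v) (g x))) (at x)" for x
    by (rule FDERIV; rule bounded_linear_imp_has_derivative) fact+
  show ?thesis
  proof (rule smooth_on_SucI)
    show "(\<lambda>x. B (f x) (g x)) differentiable (at x)" for x
      using D differentiable_def by blast
    fix v
    have "frechet_derivative (\<lambda>x. B (f x) (g x)) (at x) v = B (f x) (g v) + B (f v) (g x)" for x
      using frechet_derivative_at[OF D[of x]] by metis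
    moreover have "bounded_linear (\<lambda>x. B (f x) (g v) + B (f v) (g x))"
      by (intro bounded_linear_add bounded_linear_compose[OF bounded_linear_left]
          bounded_linear_compose[OF bounded_linear_right] assms)
    ultimately show "smooth_on S (\<lambda>x. frechet_derivative (\<lambda>x. B (f x) (g x)) (at x) v)"
      by (simp add: smooth_on_bounded_linear)
  qed
qed

text \<open>This family contains both parametrizations of the theorem and is closed under directional
  derivatives.\<close>

lemma has_derivative_exp_plane:
  fixes a b c d :: "'a::euclidean_space" and u :: "real \<times> real"
  shows "((\<lambda>(s, t). exp s *\<^sub>R a + t *\<^sub>R b + exp t *\<^sub>R c + d) has_derivative
     (\<lambda>(v, w). (v * exp (fst u)) *\<^sub>R a + w *\<^sub>R b + (w * exp (snd u)) *\<^sub>R c)) (at u)"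
  unfolding case_prod_unfold
  by (rule derivative_eq_intros refl | simp)+

lemma smooth_on_exp_plane:
  fixes a b c d :: "'a::euclidean_space"
  shows "smooth_on S (\<lambda>(s, t). exp s *\<^sub>R a + t *\<^sub>R b + exp t *\<^sub>R c + d)"
proof -
  have "Ck_on k S (\<lambda>(s, t). exp s *\<^sub>R a + t *\<^sub>R b + exp t *\<^sub>R c + d)" for k
  proof (induction k arbitrary: a b c d)
    case 0
    show ?case by (auto simp: case_prod_unfold intro!: continuous_intros)
  next
    case (Suc k)
    \<comment> \<open>Differentiation along \<open>v\<close> multiplies \<open>a\<close> and
      \<open>c\<close> by the components of \<open>v\<close> and moves a multiple of
      \<open>b\<close> into the constant term. Hence the induction generalizes over all four
      vectors.\<close>
    have "frechet_derivative (\<lambda>(s, t). exp s *\<^sub>R a + t *\<^sub>R b + exp t *\<^sub>R c + d) (at u) v =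
        (\<lambda>(s, t). exp s *\<^sub>R (fst v *\<^sub>R a) + t *\<^sub>R 0 + exp t *\<^sub>R (snd v *\<^sub>R c) + snd v *\<^sub>R b) u" for u v
      unfolding frechet_derivative_at[OF has_derivative_exp_plane, symmetric]
      by (simp add: case_prod_unfold algebra_simps)
    then have "Ck_on k S (\<lambda>u. frechet_derivative (\<lambda>(s, t). exp s *\<^sub>R a + t *\<^sub>R b + exp t *\<^sub>R c + d) (at u) v)" for v
      using Suc by presburger
    moreover have "(\<lambda>(s, t). exp s *\<^sub>R a + t *\<^sub>R b + exp t *\<^sub>R c + d) differentiable at u" for u
      using has_derivative_exp_plane differentiable_def by blast
    ultimately show ?case by simp
  qed
  then show ?thesis by (simp add: smooth_on_def)
qed

lemma smooth_on_imp_differentiable: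
  assumes "smooth_on S f" "x \<in> S"
  shows "f differentiable (at x)"
  using assms Ck_on.simps(2)[of 0 S f] by (auto simp: smooth_on_def)

section \<open>Tangent spaces of the symplectic leaves\<close>

lemma gderiv_gradient:
  assumes "f differentiable (at m)"
  shows "GDERIV f m :> gradient f m"
proof -
  obtain f' where f': "(f has_derivative f') (at m)" using assms differentiable_def by blast
  \<comment> \<open>Riesz representation: the adjoint of the functional \<open>f'\<close>, taken at
    the real number 1, is the vector representing \<open>f'\<close>.\<close>
  have "f' h = h \<bullet> adjoint f' 1" for h
    using adjoint_works[OF has_derivative_linear[OF f'], of h 1] by simp
  then have "GDERIV f m :> adjoint f' 1"
    using f' unfolding gderiv_def by (metis (no_types, lifting) ext)
  moreover have "D = adjoint f' 1" if "GDERIV f m :> D" for D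
    using has_derivative_unique[OF that[unfolded gderiv_def] \<open>GDERIV f m :> adjoint f' 1\<close>[unfolded gderiv_def]]
    by (metis inner_commute vector_eq_ldot)
  ultimately show ?thesis unfolding gradient_def by (rule theI)
qed

lemma gradient_eqI:
  assumes "GDERIV f m :> D"
  shows "gradient f m = D"
proof -
  have "GDERIV f m :> gradient f m"
    using assms gderiv_gradient unfolding gderiv_def differentiable_def by blast
  from has_derivative_unique[OF this[unfolded gderiv_def] assms[unfolded gderiv_def]]
  show ?thesis by (metis inner_commute vector_eq_ldot)
qed

text \<open>The Hamiltonian vector field of the linear function \<open>q \<mapsto> q \<bullet> Z\<close>.\<close>

definition coadjoint_field :: "se3 \<Rightarrow> se3 \<Rightarrow> se3" where
  "coadjoint_field Z q =
     (cross3 (fst Z) (fst q) + cross3 (snd Z) (snd q), cross3 (fst Z) (snd q))"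

lemma bounded_bilinear_cross3: "bounded_bilinear cross3"
  using bilinear_cross bilinear_conv_bounded_bilinear by blast

text \<open>Read with \<open>u\<close> the gradient of \<open>h\<close> at \<open>q\<close>, this
  says that the bracket of \<open>h\<close> with the linear function of \<open>Z\<close> is the
  derivative of \<open>h\<close> along \<open>coadjoint_field Z\<close>.\<close>

lemma inner_se3_bracket: "q \<bullet> se3_bracket u Z = coadjoint_field Z q \<bullet> u"
  by (simp add: coadjoint_field_def se3_bracket_def inner_prod_def cross3_simps)

lemma coadjoint_field_scaleR: "coadjoint_field (c *\<^sub>R Z) q = c *\<^sub>R coadjoint_field Z q"
  by (simp add: coadjoint_field_def cross_mult_left scaleR_add_right)

lemma continuous_on_coadjoint_field:
  "continuous_on S f \<Longrightarrow> continuous_on S (\<lambda>t. coadjoint_field Z (f t))"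
  unfolding coadjoint_field_def
  by (intro continuous_intros bounded_bilinear.continuous_on[OF bounded_bilinear_cross3])

lemma hamiltonian_step_flow:
  assumes flow: "\<And>t. (\<gamma> has_vector_derivative coadjoint_field Z (\<gamma> t)) (at t)"
    and reg: "\<And>t. \<gamma> t \<in> se3_reg"
  shows "hamiltonian_step (\<gamma> 0) (\<gamma> \<tau>)"
proof -
  \<comment> \<open>Hamiltonian curves run over the unit interval, so time is rescaled by
    \<open>\<tau>\<close> and the factor is absorbed into the Hamiltonian. This also covers negative
    \<open>\<tau>\<close>.\<close>
  let ?f = "\<lambda>q. q \<bullet> (\<tau> *\<^sub>R Z)"
  let ?c = "\<lambda>s. \<gamma> (\<tau> * s)"
  have lin: "bounded_linear ?f" by (rule bounded_linear_inner_left)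
  have grad: "gradient ?f q = \<tau> *\<^sub>R Z" for q
    by (rule gradient_eqI) (simp only: gderiv_def bounded_linear_imp_has_derivative[OF lin])
  have "((\<lambda>s. h (?c s)) has_real_derivative poisson_bracket h ?f (?c t)) (at t within {0..1})"
    if h: "smooth_on se3_reg h" for h t
  proof -
    have c: "(?c has_derivative (\<lambda>v. v *\<^sub>R (\<tau> *\<^sub>R coadjoint_field Z (?c t)))) (at t)"
    proof -
      have "(\<gamma> has_derivative (\<lambda>v. v *\<^sub>R coadjoint_field Z (?c t))) (at (\<tau> * t))"
        using flow[of "\<tau> * t"] by (simp add: has_vector_derivative_def)
      moreover have "((\<lambda>s. \<tau> * s) has_derivative (\<lambda>v. \<tau> * v)) (at t)"
        by (auto intro!: derivative_eq_intros)
      ultimately have "(?c has_derivative (\<lambda>v. (\<tau> * v) *\<^sub>R coadjoint_field Z (?c t))) (at t)"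
        by (rule has_derivative_compose[rotated])
      then show ?thesis by (simp add: mult.commute)
    qed
    have "(h has_derivative (\<lambda>v. v \<bullet> gradient h (?c t))) (at (?c t))"
      using gderiv_gradient[OF smooth_on_imp_differentiable[OF h reg]] by (simp add: gderiv_def)
    from has_derivative_compose[OF c this]
    have "((\<lambda>s. h (?c s)) has_derivative (\<lambda>v. poisson_bracket h ?f (?c t) * v)) (at t)"
      unfolding poisson_bracket_def grad inner_se3_bracket coadjoint_field_scaleR
      by (simp add: mult_ac)
    then show ?thesis
      by (simp add: has_field_derivative_def has_derivative_at_withinI)
  qed
  then have "hamiltonian_curve ?f ?c"
    using reg by (auto simp: hamiltonian_curve_def)
  moreover have "?c 0 = \<gamma> 0" "?c 1 = \<gamma> \<tau>" by simp_all
  ultimately show ?thesis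
    unfolding hamiltonian_step_def using smooth_on_bounded_linear[OF lin] by blast
qed

text \<open>Every \<open>\<gamma> t\<close> is a single Hamiltonian step away from \<open>m\<close>,
  so the whole flow line lies in the leaf and its velocity at 0 is tangent to it.\<close>

lemma tangent_space_leaf_flow:
  assumes flow: "\<And>t. (\<gamma> has_vector_derivative coadjoint_field Z (\<gamma> t)) (at t)"
    and reg: "\<And>t. \<gamma> t \<in> se3_reg" and "\<gamma> 0 = m"
  shows "coadjoint_field Z m \<in> tangent_space (symplectic_leaf m) m"
proof -
  have "continuous_on UNIV \<gamma>"
    using flow by (meson continuous_at_imp_continuous_on has_vector_derivative_continuous)
  then have "continuous_on {-1<..<1} (\<lambda>t. coadjoint_field Z (\<gamma> t))"
    using continuous_on_coadjoint_field continuous_on_subset subset_UNIV by metis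
  then have "\<gamma> C1_differentiable_on {-1<..<1}"
    using flow unfolding C1_differentiable_on_def
    by (intro exI[of _ "\<lambda>t. coadjoint_field Z (\<gamma> t)"]) simp
  moreover have "\<gamma> ` {-1<..<1} \<subseteq> symplectic_leaf m"
    using hamiltonian_step_flow[OF flow reg] \<open>\<gamma> 0 = m\<close>
    unfolding symplectic_leaf_def by (metis image_subsetI mem_Collect_eq r_into_rtranclp)
  ultimately show ?thesis
    using flow[of 0] \<open>\<gamma> 0 = m\<close> unfolding tangent_space_def by blast
qed

text \<open>The field of \<open>(0, b)\<close> fixes the second component and moves the first with
  the constant velocity \<open>cross3 b (snd m)\<close>; its flow lines are straight.\<close>

lemma tangent_space_leaf_translation:
  assumes "m \<in> se3_reg"
  shows "coadjoint_field (0, b) m \<in> tangent_space (symplectic_leaf m) m"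
proof (rule tangent_space_leaf_flow)
  let ?c = "\<lambda>t. (fst m + t *\<^sub>R cross3 b (snd m), snd m)"
  show "(?c has_vector_derivative coadjoint_field (0, b) (?c t)) (at t)" for t
    by (auto simp: coadjoint_field_def has_vector_derivative_def intro!: derivative_eq_intros)
  show "?c t \<in> se3_reg" for t using assms by (auto simp: se3_reg_def)
qed simp

text \<open>Rodrigues' formula for the rotation by the angle \<open>t\<close> about the unit vector \<open>a\<close>.\<close>

definition rotation_about :: "real^3 \<Rightarrow> real \<Rightarrow> real^3 \<Rightarrow> real^3" where
  "rotation_about a t v = cos t *\<^sub>R v + sin t *\<^sub>R cross3 a v + ((1 - cos t) * (a \<bullet> v)) *\<^sub>R a"

lemma has_vector_derivative_rotation_about:
  assumes "norm a = 1"
  shows "((\<lambda>t. rotation_about a t v) has_vector_derivative cross3 a (rotation_about a t v)) (at t)"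
proof -
  \<comment> \<open>For a unit vector the double cross product with \<open>a\<close> is minus the
    projection orthogonal to \<open>a\<close>; this turns the cross product of Rodrigues' formula
    into its derivative.\<close>
  have "a \<bullet> a = 1" using assms by (simp add: norm_eq_1)
  then have "cross3 a (cross3 a v) = (a \<bullet> v) *\<^sub>R a - v"
    using Lagrange[of a a v] by simp
  then have aav: "sin t *\<^sub>R cross3 a (cross3 a v) = sin t *\<^sub>R ((a \<bullet> v) *\<^sub>R a - v)"
    by simp
  have "cross3 a (rotation_about a t v) =
      (- sin t) *\<^sub>R v + cos t *\<^sub>R cross3 a v + (sin t * (a \<bullet> v)) *\<^sub>R a"
    unfolding rotation_about_def cross_add_right cross_mult_right aav
    by (simp add: algebra_simps)
  moreover have "((\<lambda>t. rotation_about a t v) has_vector_derivative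
      (- sin t) *\<^sub>R v + cos t *\<^sub>R cross3 a v + (sin t * (a \<bullet> v)) *\<^sub>R a) (at t)"
    unfolding rotation_about_def has_vector_derivative_def
    by (auto intro!: derivative_eq_intros simp: algebra_simps)
  ultimately show ?thesis by simp
qed

text \<open>The velocity is orthogonal to the rotated vector, so its squared length is constant.
  This keeps the rotational flow inside \<open>se3_reg\<close>.\<close>

lemma norm_rotation_about:
  assumes "norm a = 1"
  shows "rotation_about a t v \<bullet> rotation_about a t v = v \<bullet> v"
proof -
  have "rotation_about a t v \<bullet> cross3 a (rotation_about a t v) = 0"
    "cross3 a (rotation_about a t v) \<bullet> rotation_about a t v = 0" for t
    by (simp_all add: dot_cross_self)
  then have "((\<lambda>t. rotation_about a t v \<bullet> rotation_about a t v) has_real_derivative 0) (at t)" for t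
    using has_derivative_inner[OF has_vector_derivative_rotation_about[OF assms, of v t, unfolded has_vector_derivative_def]
        has_vector_derivative_rotation_about[OF assms, of v t, unfolded has_vector_derivative_def]]
    by (simp add: has_field_derivative_def lambda_zero)
  then have "rotation_about a t v \<bullet> rotation_about a t v = rotation_about a 0 v \<bullet> rotation_about a 0 v"
    using DERIV_isconst_all by blast
  then show ?thesis by (simp add: rotation_about_def)
qed

text \<open>The flow of \<open>(a, 0)\<close> rotates both components simultaneously about the axis
  \<open>a\<close>.\<close>

lemma tangent_space_leaf_rotation:
  assumes "m \<in> se3_reg" "norm a = 1"
  shows "coadjoint_field (a, 0) m \<in> tangent_space (symplectic_leaf m) m"
proof (rule tangent_space_leaf_flow)
  let ?c = "\<lambda>t. (rotation_about a t (fst m), rotation_about a t (snd m))"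
  show "(?c has_vector_derivative coadjoint_field (a, 0) (?c t)) (at t)" for t
    using has_vector_derivative_rotation_about[OF assms(2)]
    by (simp add: coadjoint_field_def has_vector_derivative_def has_derivative_Pair)
  show "?c t \<in> se3_reg" for t
    using assms norm_rotation_about[OF assms(2), of t "snd m"]
    by (simp add: se3_reg_def case_prod_unfold del: inner_eq_zero_iff)
qed (simp add: rotation_about_def)

section \<open>Casimirs and the annihilator of the tangent spaces\<close>

lemma casimir_constant_on_leaf:
  assumes "smooth_on se3_reg c" and "\<And>f q. q \<in> se3_reg \<Longrightarrow> poisson_bracket c f q = 0"
    and "m' \<in> symplectic_leaf m"
  shows "c m' = c m"
proof -
  have step_eq: "c q' = c q" if step: "hamiltonian_step q q'" for q q'
  proof -
    obtain f \<gamma> where "hamiltonian_curve f \<gamma>" and ends: "\<gamma> 0 = q" "\<gamma> 1 = q'"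
      using step unfolding hamiltonian_step_def by blast
    \<comment> \<open>Along a Hamiltonian curve of \<open>f\<close> the derivative of
      \<open>c\<close> is its bracket with \<open>f\<close>, which vanishes for a Casimir.\<close>
    then have "((\<lambda>s. c (\<gamma> s)) has_real_derivative 0) (at t within {0..1})" if "t \<in> {0..1}" for t
      using assms(1,2) that unfolding hamiltonian_curve_def by (metis image_subset_iff)
    then have "\<exists>k. \<forall>t\<in>{0..1}. c (\<gamma> t) = k"
      by (intro has_field_derivative_zero_constant convex_real_interval)
    then obtain k where "\<And>t. t \<in> {0..1} \<Longrightarrow> c (\<gamma> t) = k" by blast
    from this[of 0] this[of 1] show ?thesis by (simp add: ends)
  qed
  have "c q = c m" if "hamiltonian_step\<^sup>*\<^sup>* m q" for q
    using that
  proof induction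
    case (step y z)
    then show ?case using step_eq[OF step.hyps(2)] by simp
  qed simp
  then show ?thesis using assms(3) unfolding symplectic_leaf_def by blast
qed

text \<open>Along a curve in the leaf \<open>c\<close> is constant; the chain rule at time 0 then
  gives the orthogonality.\<close>

lemma casimir_gradient_orthogonal:
  assumes "smooth_on se3_reg c" and "\<And>f q. q \<in> se3_reg \<Longrightarrow> poisson_bracket c f q = 0"
    and D: "GDERIV c m :> D" and w: "w \<in> tangent_space (symplectic_leaf m) m"
  shows "w \<bullet> D = 0"
proof -
  obtain \<gamma> where sub: "\<gamma> ` {-1<..<1} \<subseteq> symplectic_leaf m" and "\<gamma> 0 = m"
    and "(\<gamma> has_vector_derivative w) (at 0)"
    using w unfolding tangent_space_def by blast
  then have "((\<lambda>t. c (\<gamma> t)) has_derivative (\<lambda>v. (v *\<^sub>R w) \<bullet> D)) (at 0)"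
    using D has_derivative_compose[of \<gamma> "\<lambda>v. v *\<^sub>R w" 0 UNIV c "\<lambda>h. h \<bullet> D"]
    by (simp add: gderiv_def has_vector_derivative_def)
  moreover have "((\<lambda>t. c (\<gamma> t)) has_derivative (\<lambda>v. 0)) (at 0)"
  proof (rule has_derivative_transform_within_open[where s = "{-1<..<1}"])
    show "c m = c (\<gamma> t)" if "t \<in> {-1<..<1}" for t
    proof (rule casimir_constant_on_leaf[symmetric])
      show "\<gamma> t \<in> symplectic_leaf m" using sub that by blast
    qed (fact assms(1,2))+
  qed auto
  ultimately have "(\<lambda>v. (v *\<^sub>R w) \<bullet> D) = (\<lambda>v. 0)" by (rule has_derivative_unique)
  from fun_cong[OF this, of 1] show ?thesis by simp
qed

text \<open>The two vectors are, up to a factor 2, the gradients of the Casimirs. Their brackets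
  with every \<open>f\<close> vanish by identities of the triple product.\<close>

lemma tangent_space_leaf_orthogonal:
  assumes w: "w \<in> tangent_space (symplectic_leaf m) m"
  shows "w \<bullet> (snd m, fst m) = 0" "w \<bullet> (0, snd m) = 0"
proof -
  have 1: "GDERIV (\<lambda>q. fst q \<bullet> snd q) q :> (snd q, fst q)" for q :: se3
    unfolding gderiv_def by (auto intro!: derivative_eq_intros simp: inner_prod_def inner_commute)
  have 2: "GDERIV (\<lambda>q. snd q \<bullet> snd q) q :> (0, 2 *\<^sub>R snd q)" for q :: se3
    unfolding gderiv_def by (auto intro!: derivative_eq_intros simp: inner_prod_def inner_commute)
  show "w \<bullet> (snd m, fst m) = 0"
  proof (rule casimir_gradient_orthogonal[OF _ _ 1 w])
    show "smooth_on se3_reg (\<lambda>q. fst q \<bullet> snd q)"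
      by (intro smooth_on_bilinear bounded_bilinear_inner bounded_linear_fst bounded_linear_snd)
    show "poisson_bracket (\<lambda>q. fst q \<bullet> snd q) f q = 0" for f q
      unfolding poisson_bracket_def gradient_eqI[OF 1]
      by (simp add: se3_bracket_def inner_prod_def cross3_simps)
  qed
  have "w \<bullet> (0, 2 *\<^sub>R snd m) = 0"
  proof (rule casimir_gradient_orthogonal[OF _ _ 2 w])
    show "smooth_on se3_reg (\<lambda>q. snd q \<bullet> snd q)"
      by (intro smooth_on_bilinear bounded_bilinear_inner bounded_linear_snd)
    show "poisson_bracket (\<lambda>q. snd q \<bullet> snd q) f q = 0" for f q
      unfolding poisson_bracket_def gradient_eqI[OF 2]
      by (simp add: se3_bracket_def inner_prod_def cross3_simps)
  qed
  then show "w \<bullet> (0, snd m) = 0" by (simp add: inner_prod_def)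
qed

lemma span_pair: "span {a, b} = {c *\<^sub>R a + d *\<^sub>R b | c d. True}"
proof -
  have "x \<in> span {a, b} \<longleftrightarrow> (\<exists>c d. x = c *\<^sub>R a + d *\<^sub>R b)" for x
    by (simp add: span_breakdown_eq algebra_simps eq_diff_eq)
  then show ?thesis by blast
qed

lemma cross_eq_0_imp_scaleR:
  assumes "p \<noteq> (0 :: real^3)" "cross3 p y = 0"
  obtains c where "y = c *\<^sub>R p"
  using assms unfolding cross_eq_0 collinear_lemma by auto

text \<open>Instead of a dimension count, \<open>Y\<close> is tested against the explicit tangent
  vectors: translations make its first component a multiple \<open>c\<close> of \<open>p\<close>,
  and rotations make the rest of its second component, after \<open>c *\<^sub>R x\<close> is
  removed, a multiple of \<open>p\<close>.\<close>

lemma orthogonal_tangent_space_leaf: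
  assumes m: "m \<in> se3_reg" and Y: "\<And>w. w \<in> tangent_space (symplectic_leaf m) m \<Longrightarrow> Y \<bullet> w = 0"
  shows "Y \<in> span {(snd m, fst m), (0, snd m)}"
proof -
  obtain x p where xp: "m = (x, p)" "p \<noteq> 0" using m by (auto simp: se3_reg_def)
  obtain y r where Yyr: "Y = (y, r)" by (cases Y)
  have "cross3 p y \<bullet> b = 0" for b
    using Y[OF tangent_space_leaf_translation[OF m, of b]]
    by (simp add: Yyr xp coadjoint_field_def inner_prod_def cross3_simps)
  then have "cross3 p y = 0" by (metis inner_eq_zero_iff)
  then obtain c where c: "y = c *\<^sub>R p" using cross_eq_0_imp_scaleR xp by blast
  \<comment> \<open>By cyclicity of the triple product, \<open>z \<bullet> a\<close> is the pairing
    of \<open>Y\<close> with the tangent vector of the rotation about \<open>a\<close>.\<close>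
  define z where "z = cross3 x y + cross3 p r"
  have "z \<bullet> a = 0" if "norm a = 1" for a
    using Y[OF tangent_space_leaf_rotation[OF m that]]
    by (simp add: z_def Yyr xp coadjoint_field_def inner_prod_def cross3_simps)
  \<comment> \<open>Only unit axes are available, so the axis is taken along \<open>z\<close>
    itself, which yields the norm of \<open>z\<close>.\<close>
  then have "z \<bullet> sgn z = 0" if "z \<noteq> 0" using that by (simp add: norm_sgn)
  then have "z = 0" by (auto simp: sgn_div_norm)
  moreover have "z = cross3 p (r - c *\<^sub>R x)"
    by (simp add: z_def c cross3_simps)
  ultimately obtain d where "r - c *\<^sub>R x = d *\<^sub>R p"
    using cross_eq_0_imp_scaleR xp by metis
  then have "r = c *\<^sub>R x + d *\<^sub>R p" by (simp add: algebra_simps)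
  then have "Y = c *\<^sub>R (snd m, fst m) + d *\<^sub>R (0, snd m)"
    by (simp add: Yyr xp c)
  then show ?thesis unfolding span_pair by blast
qed

section \<open>Invariant metrics and the normal distribution\<close>

text \<open>Invariance is evaluated on the standard basis: equations whose cross products are basis
  vectors up to sign, or zero, kill the off-diagonal entries and equate the diagonal ones.\<close>

lemma cross_invariant_form:
  fixes B :: "real^3 \<Rightarrow> real^3 \<Rightarrow> real"
  assumes B: "bilinear B" and inv: "\<And>z x y. B (cross3 z x) y + B x (cross3 z y) = 0"
  shows "B x y = B (axis 1 1) (axis 1 1) * (x \<bullet> y)"
proof -
  let ?e = "\<lambda>i::3. axis i (1::real) :: real^3"
  note bl = bilinear_lneg[OF B] bilinear_rneg[OF B] bilinear_lzero[OF B] bilinear_rzero[OF B]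
  \<comment> \<open>Both orders of each pair are listed because the lemma is also applied to the
    mixed block of \<open>g\<close>, whose symmetry is not known beforehand.\<close>
  have ortho: "B (?e 1) (?e 2) = 0" "B (?e 2) (?e 1) = 0" "B (?e 1) (?e 3) = 0"
      "B (?e 3) (?e 1) = 0" "B (?e 2) (?e 3) = 0" "B (?e 3) (?e 2) = 0"
    using inv[of "?e 1" "?e 1" "?e 3"] inv[of "?e 1" "?e 3" "?e 1"] inv[of "?e 1" "?e 1" "?e 2"]
      inv[of "?e 1" "?e 2" "?e 1"] inv[of "?e 2" "?e 2" "?e 1"] inv[of "?e 2" "?e 1" "?e 2"]
    by (simp_all add: cross_basis bl)
  have diag: "B (?e 2) (?e 2) = B (?e 1) (?e 1)" "B (?e 3) (?e 3) = B (?e 1) (?e 1)"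
    using inv[of "?e 3" "?e 1" "?e 2"] inv[of "?e 2" "?e 3" "?e 1"]
    by (simp_all add: cross_basis bl)
  have "bilinear (\<lambda>x y. B (?e 1) (?e 1) * (x \<bullet> y))"
    unfolding bilinear_def linear_iff by (auto simp: inner_add_left inner_add_right algebra_simps)
  moreover have basis: "B i j = B (?e 1) (?e 1) * (i \<bullet> j)" if ij: "i \<in> Basis" "j \<in> Basis" for i j
  proof -
    have "\<exists>k. b = ?e k" if "b \<in> Basis" for b
      using that by (auto simp: Basis_vec_def)
    then obtain k l where "i = ?e k" "j = ?e l" using ij by blast
    then show ?thesis
      using exhaust_3[of k] exhaust_3[of l]
      by (elim disjE) (simp_all add: ortho diag inner_axis_axis)
  qed
  ultimately have "B = (\<lambda>x y. B (?e 1) (?e 1) * (x \<bullet> y))"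
    using bilinear_eq_stdbasis[OF B] basis by blast
  from fun_cong[OF fun_cong[OF this]] show ?thesis .
qed

text \<open>Rotations \<open>(z, 0)\<close> make every block a multiple of the scalar product,
  translations \<open>(0, z)\<close> kill the lower right block, and non-degeneracy excludes \<beta>
  = 0.\<close>

lemma ad_invariant_metric_form:
  assumes g: "constant_metric g" "ad_invariant g"
  obtains \<alpha> \<beta> where "\<beta> \<noteq> 0"
    "\<And>X Y. g X Y = \<alpha> * (fst X \<bullet> fst Y) + \<beta> * (fst X \<bullet> snd Y + snd X \<bullet> fst Y)"
proof -
  have bil: "bilinear g" and sym: "\<And>X Y. g X Y = g Y X"
    and nondeg: "\<And>X. (\<And>Y. g X Y = 0) \<Longrightarrow> X = 0"
    using g(1) unfolding constant_metric_def by blast+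
  have inv: "g (se3_bracket Z X) Y + g X (se3_bracket Z Y) = 0" for X Y Z
    using g(2) unfolding ad_invariant_def by blast
  have bil': "bilinear (\<lambda>x y. g (f x) (h y))" if "linear f" "linear h" for f h :: "real^3 \<Rightarrow> se3"
    using bil that linear_compose[of h "g (f x)" for x] linear_compose[of f "\<lambda>X. g X (h y)" for y]
    unfolding bilinear_def o_def by blast
  have lin: "linear (\<lambda>x::real^3. (x, 0::real^3))" "linear (\<lambda>p::real^3. (0::real^3, p))"
    by (simp_all add: linear_iff)
  define \<alpha> where "\<alpha> = g (axis 1 1, 0) (axis 1 1, 0)"
  define \<beta> where "\<beta> = g (axis 1 1, 0) (0, axis 1 1)"
  have aa: "g (x, 0) (y, 0) = \<alpha> * (x \<bullet> y)" for x y
    unfolding \<alpha>_def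
  proof (rule cross_invariant_form[OF bil'[OF lin(1) lin(1)]])
    show "g (cross3 z x, 0) (y, 0) + g (x, 0) (cross3 z y, 0) = 0" for z x y
      using inv[of "(z, 0)" "(x, 0)" "(y, 0)"] by (simp add: se3_bracket_def)
  qed
  have bb: "g (x, 0) (0, y) = \<beta> * (x \<bullet> y)" for x y
    unfolding \<beta>_def
  proof (rule cross_invariant_form[OF bil'[OF lin]])
    show "g (cross3 z x, 0) (0, y) + g (x, 0) (0, cross3 z y) = 0" for z x y
      using inv[of "(z, 0)" "(x, 0)" "(0, y)"] by (simp add: se3_bracket_def)
  qed
  \<comment> \<open>The bracket with \<open>(0, z)\<close> sends \<open>(x, 0)\<close> to
    \<open>(0, cross3 z x)\<close> and annihilates \<open>(0, y)\<close>. Every basis vector is such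
    a cross product.\<close>
  have "g (0, cross3 z x) (0, y) = 0" for x y z
    using inv[of "(0, z)" "(x, 0)" "(0, y)"] by (simp add: se3_bracket_def bilinear_rzero[OF bil]
        flip: zero_prod_def)
  then have "g (0, axis 1 1) (0, axis 1 1) = 0" by (metis cross_basis(3))
  moreover have "g (0, x) (0, y) = g (0, axis 1 1) (0, axis 1 1) * (x \<bullet> y)" for x y
  proof (rule cross_invariant_form[OF bil'[OF lin(2) lin(2)]])
    show "g (0, cross3 z x) (0, y) + g (0, x) (0, cross3 z y) = 0" for z x y
      using inv[of "(z, 0)" "(0, x)" "(0, y)"] by (simp add: se3_bracket_def)
  qed
  ultimately have cc: "g (0, x) (0, y) = 0" for x y
    by (metis mult_zero_left)
  have form: "g X Y = \<alpha> * (fst X \<bullet> fst Y) + \<beta> * (fst X \<bullet> snd Y + snd X \<bullet> fst Y)" for X Y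
  proof -
    have "g X Y = g ((fst X, 0) + (0, snd X)) ((fst Y, 0) + (0, snd Y))" by simp
    also have "\<dots> = g (fst X, 0) (fst Y, 0) + g (fst X, 0) (0, snd Y)
        + g (fst Y, 0) (0, snd X) + g (0, snd X) (0, snd Y)"
      unfolding bilinear_ladd[OF bil] bilinear_radd[OF bil] sym[of "(0, snd X)" "(fst Y, 0)"]
      by (simp only: add.assoc)
    finally show ?thesis by (simp add: aa bb cc inner_commute algebra_simps)
  qed
  moreover have "\<beta> \<noteq> 0"
  proof
    assume "\<beta> = 0"
    then have "(0, axis 1 1) = (0 :: se3)" by (intro nondeg) (simp add: form)
    then show False by (simp add: zero_prod_def)
  qed
  ultimately show ?thesis using that by blast
qed

text \<open>A vector is normal iff its preimage under the matrix \<open>G\<close> of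
  \<open>g\<close> annihilates the tangent space of the leaf, that is, iff that preimage combines
  the Casimir differentials. The map \<open>H\<close> is the inverse of \<open>G\<close>.\<close>

lemma normal_distribution_eq:
  assumes g: "constant_metric g" "ad_invariant g" and m: "m \<in> se3_reg"
  shows "normal_distribution g m = span {m, (snd m, 0)}"
proof -
  obtain \<alpha> \<beta> where "\<beta> \<noteq> 0"
    and form: "\<And>X Y. g X Y = \<alpha> * (fst X \<bullet> fst Y) + \<beta> * (fst X \<bullet> snd Y + snd X \<bullet> fst Y)"
    by (rule ad_invariant_metric_form[OF g]) (rule that)
  define G :: "se3 \<Rightarrow> se3" where "G X = (\<alpha> *\<^sub>R fst X + \<beta> *\<^sub>R snd X, \<beta> *\<^sub>R fst X)" for X
  define H :: "se3 \<Rightarrow> se3" where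
    "H v = (snd v /\<^sub>R \<beta>, (fst v - (\<alpha> / \<beta>) *\<^sub>R snd v) /\<^sub>R \<beta>)" for v
  have G: "G X \<bullet> Y = g X Y" for X Y
    by (simp add: G_def form inner_prod_def inner_add_left algebra_simps)
  have metric_map: "metric_map g = G"
  proof
    fix X show "metric_map g X = G X"
      unfolding metric_map_def G[symmetric] vector_eq_rdot by simp
  qed
  have HG: "H (G X) = X" and GH: "G (H v) = v" for X v
    using \<open>\<beta> \<noteq> 0\<close> by (simp_all add: G_def H_def prod_eq_iff scaleR_add_right scaleR_diff_right field_simps)
  then have "inv (metric_map g) = H"
    unfolding metric_map by (intro inv_equality) auto
  \<comment> \<open>\<open>g (H v) (H w)\<close> is the Euclidean product of \<open>H v\<close> with
    \<open>G (H w)\<close>, which equals \<open>w\<close>.\<close>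
  then have perp: "inverse_metric g v w = H v \<bullet> w" for v w
    using g(1) G[of "H w" "H v"] unfolding inverse_metric_def constant_metric_def GH
    by (metis inner_commute)
  show ?thesis
  proof (intro equalityI subsetI)
    fix v assume "v \<in> normal_distribution g m"
    then have "H v \<bullet> w = 0" if "w \<in> tangent_space (symplectic_leaf m) m" for w
      using that by (auto simp: normal_distribution_def perp)
    then have "H v \<in> span {(snd m, fst m), (0, snd m)}"
      by (rule orthogonal_tangent_space_leaf[OF m])
    then obtain c d where "H v = c *\<^sub>R (snd m, fst m) + d *\<^sub>R (0, snd m)"
      unfolding span_pair by blast
    then have "v = G (c *\<^sub>R (snd m, fst m) + d *\<^sub>R (0, snd m))" using GH by metis
    \<comment> \<open>\<open>G\<close> sends \<open>(p, x)\<close> to \<beta> \<open>m\<close> +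
      \<alpha> \<open>(p, 0)\<close> and \<open>(0, p)\<close> to \<beta> \<open>(p, 0)\<close>.
      Since \<beta> is nonzero, the span of the images does not depend on the metric.\<close>
    also have "\<dots> = (c * \<beta>) *\<^sub>R m + (c * \<alpha> + d * \<beta>) *\<^sub>R (snd m, 0)"
      by (simp add: G_def prod_eq_iff algebra_simps)
    finally show "v \<in> span {m, (snd m, 0)}" unfolding span_pair by blast
  next
    fix v assume "v \<in> span {m, (snd m, 0)}"
    then obtain c d where v: "v = c *\<^sub>R m + d *\<^sub>R (snd m, 0)" unfolding span_pair by blast
    have "H v \<bullet> w = 0" if w: "w \<in> tangent_space (symplectic_leaf m) m" for w
    proof -
      have "H v = (c / \<beta>) *\<^sub>R (snd m, fst m) + ((d - c * \<alpha> / \<beta>) / \<beta>) *\<^sub>R (0, snd m)"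
        by (simp add: H_def v prod_eq_iff algebra_simps divide_inverse)
      then show ?thesis
        using tangent_space_leaf_orthogonal[OF w]
        by (simp only: inner_commute[of _ w] inner_add_right inner_scaleR_right mult_zero_right add_0)
    qed
    then show "v \<in> normal_distribution g m" by (simp add: normal_distribution_def perp)
  qed
qed

section \<open>Integral submanifolds and first integrals\<close>

text \<open>\<open>F\<close> is locally constant for the topology \<open>T\<close>, since the
  derivative of \<open>F\<close> composed with a chart vanishes. The predicate \<open>P\<close> lets
  one lemma serve for level sets and for their complements.\<close>

lemma integral_submanifold_openin_level:
  assumes T: "integral_submanifold M D T"
    and F: "\<And>q. q \<in> M \<Longrightarrow> \<exists>F'. (F has_derivative F') (at q) \<and> (\<forall>v\<in>D q. F' v = 0)"
  shows "openin T {q \<in> topspace T. P (F q)}"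
proof (subst openin_subopen, intro ballI)
  fix q assume q: "q \<in> {q \<in> topspace T. P (F q)}"
  then obtain U V \<phi> where "open U" and V: "openin T V" "q \<in> V"
    and hom: "homeomorphic_map (top_of_set U) (subtopology T V) \<phi>"
    and imm: "integral_immersion D U \<phi>"
    using T unfolding integral_submanifold_def by blast
  have image: "\<phi> ` U = V"
    using homeomorphic_imp_surjective_map[OF hom] openin_subset[OF V(1)] by auto
  then obtain u where u: "u \<in> U" "\<phi> u = q" using V(2) by blast
  \<comment> \<open>The chart domain \<open>U\<close> may be disconnected; on a ball, a vanishing
    derivative does force constancy.\<close>
  then obtain e where "e > 0" and e: "ball u e \<subseteq> U"
    using \<open>open U\<close> open_contains_ball by blast
  have "((\<lambda>x. F (\<phi> x)) has_derivative (\<lambda>h. 0)) (at x within ball u e)" if "x \<in> ball u e" for x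
  proof -
    have x: "x \<in> U" using that e by blast
    then have "\<phi> x \<in> M"
      using image openin_subset[OF V(1)] T unfolding integral_submanifold_def by blast
    then obtain F' where F': "(F has_derivative F') (at (\<phi> x))" "\<forall>v\<in>D (\<phi> x). F' v = 0"
      using F by blast
    have "(\<phi> has_derivative frechet_derivative \<phi> (at x)) (at x)"
      using imm x unfolding integral_immersion_def
      by (metis frechet_derivative_works smooth_on_imp_differentiable)
    from has_derivative_compose[OF this F'(1)]
    have "((\<lambda>x. F (\<phi> x)) has_derivative (\<lambda>h. F' (frechet_derivative \<phi> (at x) h))) (at x)" .
    moreover have "frechet_derivative \<phi> (at x) h \<in> D (\<phi> x)" for h
      using imm x unfolding integral_immersion_def by blast
    ultimately have "((\<lambda>x. F (\<phi> x)) has_derivative (\<lambda>h. 0)) (at x)"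
      using F'(2) by simp
    then show ?thesis by (rule has_derivative_at_withinI)
  qed
  then have "\<exists>c. \<forall>x\<in>ball u e. F (\<phi> x) = c"
    by (intro has_derivative_zero_constant convex_ball)
  then have const: "F (\<phi> x) = F q" if "x \<in> ball u e" for x
    using that u \<open>e > 0\<close> by (metis centre_in_ball)
  have "openin (top_of_set U) (ball u e)"
    using e by (simp add: openin_open_eq \<open>open U\<close>)
  then have "openin (subtopology T V) (\<phi> ` ball u e)"
    using homeomorphic_imp_open_map[OF hom] unfolding open_map_def by blast
  then have op: "openin T (\<phi> ` ball u e)"
    using V(1) openin_trans_full by blast
  show "\<exists>W. openin T W \<and> q \<in> W \<and> W \<subseteq> {q \<in> topspace T. P (F q)}"
  proof (intro exI conjI)
    show "openin T (\<phi> ` ball u e)" by fact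
    show "q \<in> \<phi> ` ball u e" using u \<open>e > 0\<close> by force
    show "\<phi> ` ball u e \<subseteq> {q \<in> topspace T. P (F q)}"
      using openin_subset[OF op] const q by auto
  qed
qed

text \<open>Each level set of \<open>F\<close> is open and closed in the connected space
  \<open>T\<close>.\<close>

lemma first_integral_constant:
  assumes T: "integral_submanifold M D T" and "connected_space T"
    and F: "\<And>q. q \<in> M \<Longrightarrow> \<exists>F'. (F has_derivative F') (at q) \<and> (\<forall>v\<in>D q. F' v = 0)"
    and q: "q \<in> topspace T" "q' \<in> topspace T"
  shows "F q' = F q"
proof -
  let ?S = "{r \<in> topspace T. F r = F q}"
  have "topspace T - ?S = {r \<in> topspace T. F r \<noteq> F q}" by blast
  then have "openin T ?S" "closedin T ?S"
    using integral_submanifold_openin_level[OF T F, of "\<lambda>v. v = F q"]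
      integral_submanifold_openin_level[OF T F, of "\<lambda>v. v \<noteq> F q"]
    by (auto simp: closedin_def)
  then have "?S = {} \<or> ?S = topspace T"
    using \<open>connected_space T\<close> unfolding connected_space_clopen_in by blast
  then show ?thesis using q by blast
qed

section \<open>The distribution spanned by \<open>(x, p)\<close> and \<open>(p, 0)\<close>\<close>

lemma leaf_coordinates_eq:
  fixes m :: se3
  assumes "m \<in> se3_reg" "a *\<^sub>R m + b *\<^sub>R (snd m, 0) = c *\<^sub>R m + d *\<^sub>R (snd m, 0)"
  shows "a = c \<and> b = d"
  using assms by (auto simp: se3_reg_def prod_eq_iff)

lemma open_se3_reg: "open se3_reg"
proof -
  have "se3_reg = {q. snd q \<bullet> snd q \<noteq> 0}" by (auto simp: se3_reg_def)
  moreover have "open {q::se3. snd q \<bullet> snd q \<noteq> 0}"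
    by (intro open_Collect_neq continuous_intros)
  ultimately show ?thesis by simp
qed

text \<open>The two spanning fields are linear and form a global frame, so \<open>U\<close> can be
  all of \<open>se3_reg\<close>.\<close>

lemma smooth_distribution2_se3:
  assumes D: "\<And>q. q \<in> se3_reg \<Longrightarrow> D q = span {q, (snd q, 0)}"
  shows "smooth_distribution2 se3_reg D"
  unfolding smooth_distribution2_def
proof
  fix m assume "m \<in> se3_reg"
  have "dim (D q) = 2 \<and> D q = span {q, (snd q, 0)}" if q: "q \<in> se3_reg" for q
  proof -
    have "q \<notin> span {(snd q, 0)}" and "(snd q, 0) \<noteq> (0 :: se3)"
      using q by (auto simp: span_singleton se3_reg_def zero_prod_def)
    moreover from this have "q \<noteq> (snd q, 0)" by (metis insertI1 span_base)
    ultimately have "q \<noteq> (snd q, 0)" "independent {q, (snd q, 0)}"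
      by (auto simp: independent_insert)
    then show ?thesis
      using D[OF q] by (simp add: dim_eq_card_independent)
  qed
  moreover have "smooth_on se3_reg (\<lambda>q. q)" "smooth_on se3_reg (\<lambda>q. (snd q, 0))"
    by (intro smooth_on_bounded_linear bounded_linear_intros)+
  ultimately show "\<exists>U X Y. open U \<and> m \<in> U \<and> U \<subseteq> se3_reg \<and> smooth_on U X \<and> smooth_on U Y \<and>
      (\<forall>q\<in>U. dim (D q) = 2 \<and> D q = span {X q, Y q})"
    using open_se3_reg \<open>m \<in> se3_reg\<close> by blast
qed

text \<open>Common to both parametrizations: \<open>h\<close> is the coefficient of
  \<open>(p, 0)\<close> and \<open>k\<close> its derivative with respect to the second
  parameter.\<close>

lemma integral_immersion_se3:
  assumes D: "\<And>q. q \<in> se3_reg \<Longrightarrow> D q = span {q, (snd q, 0)}" and m: "m \<in> se3_reg"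
    and smooth: "smooth_on UNIV f"
    and f: "\<And>u. f u = exp (fst u) *\<^sub>R m + h u *\<^sub>R (snd m, 0)"
    and f': "\<And>u. (f has_derivative
      (\<lambda>v. (fst v * exp (fst u)) *\<^sub>R m + (snd v * k u) *\<^sub>R (snd m, 0))) (at u)"
    and k: "\<And>u. k u \<noteq> 0"
  shows "integral_immersion D UNIV f"
  unfolding integral_immersion_def
proof (intro conjI ballI smooth)
  fix u :: "real \<times> real"
  have df: "frechet_derivative f (at u) =
      (\<lambda>v. (fst v * exp (fst u)) *\<^sub>R m + (snd v * k u) *\<^sub>R (snd m, 0))"
    using frechet_derivative_at[OF f'] by metis
  show "inj (frechet_derivative f (at u))"
  proof (rule injI)
    fix v w assume "frechet_derivative f (at u) v = frechet_derivative f (at u) w"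
    from leaf_coordinates_eq[OF m this[unfolded df]] show "v = w"
      using k[of u] by (simp add: prod_eq_iff)
  qed
  have reg: "f u \<in> se3_reg" using m by (auto simp: f se3_reg_def)
  \<comment> \<open>The frame at \<open>f u\<close> in terms of the frame at \<open>m\<close>: a
    triangular change with diagonal entries \<open>exp (fst u)\<close>, hence invertible.\<close>
  have comb: "a *\<^sub>R f u + b *\<^sub>R (snd (f u), 0) =
      (a * exp (fst u)) *\<^sub>R m + (a * h u + b * exp (fst u)) *\<^sub>R (snd m, 0)" for a b
    by (simp add: f prod_eq_iff algebra_simps)
  have "z \<in> range (frechet_derivative f (at u)) \<longleftrightarrow> z \<in> D (f u)" for z
  proof
    assume "z \<in> range (frechet_derivative f (at u))"
    then obtain v where "z = (fst v * exp (fst u)) *\<^sub>R m + (snd v * k u) *\<^sub>R (snd m, 0)"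
      unfolding df by blast
    then have "z = fst v *\<^sub>R f u + ((snd v * k u - fst v * h u) / exp (fst u)) *\<^sub>R (snd (f u), 0)"
      unfolding comb by simp
    then show "z \<in> D (f u)" unfolding D[OF reg] span_pair by blast
  next
    assume "z \<in> D (f u)"
    then obtain a b where "z = a *\<^sub>R f u + b *\<^sub>R (snd (f u), 0)"
      unfolding D[OF reg] span_pair by blast
    then have "z = frechet_derivative f (at u) (a, (a * h u + b * exp (fst u)) / k u)"
      unfolding comb df using k[of u] by simp
    then show "z \<in> range (frechet_derivative f (at u))" by blast
  qed
  then show "range (frechet_derivative f (at u)) = D (f u)" by blast
qed

section \<open>The two charts and the submanifold structure of a leaf\<close>

definition leaf_chart :: "se3 \<Rightarrow> real \<times> real \<Rightarrow> se3" where
  "leaf_chart m = (\<lambda>(s, t). exp s *\<^sub>R m + t *\<^sub>R (snd m, 0))"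

text \<open>Here the coefficient of \<open>(p, 0)\<close> is also forced to be positive. For regular
  \<open>m\<close> the range therefore omits \<open>m\<close>, which has the
  \<open>leaf_chart\<close> coordinates \<open>(0, 0)\<close>.\<close>

definition exp_chart :: "se3 \<Rightarrow> real \<times> real \<Rightarrow> se3" where
  "exp_chart m = (\<lambda>(s, t). exp s *\<^sub>R m + exp t *\<^sub>R (snd m, 0))"

lemma leaf_chart_0: "leaf_chart m (0, 0) = m"
  by (simp add: leaf_chart_def prod_eq_iff)

lemma integral_immersion_leaf_chart:
  assumes D: "\<And>q. q \<in> se3_reg \<Longrightarrow> D q = span {q, (snd q, 0)}" and m: "m \<in> se3_reg"
  shows "integral_immersion D UNIV (leaf_chart m)"
proof (rule integral_immersion_se3[OF D m, where h = snd and k = "\<lambda>_. 1"])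
  show "smooth_on UNIV (leaf_chart m)"
    using smooth_on_exp_plane[of UNIV m "(snd m, 0)" 0 0] by (simp add: leaf_chart_def)
  show "(leaf_chart m has_derivative
      (\<lambda>v. (fst v * exp (fst u)) *\<^sub>R m + (snd v * 1) *\<^sub>R (snd m, 0))) (at u)" for u
    using has_derivative_exp_plane[of m "(snd m, 0)" 0 0 u]
    by (simp add: leaf_chart_def case_prod_unfold)
qed (simp_all add: leaf_chart_def case_prod_unfold)

lemma integral_immersion_exp_chart:
  assumes D: "\<And>q. q \<in> se3_reg \<Longrightarrow> D q = span {q, (snd q, 0)}" and m: "m \<in> se3_reg"
  shows "integral_immersion D UNIV (exp_chart m)"
proof (rule integral_immersion_se3[OF D m, where h = "\<lambda>u. exp (snd u)" and k = "\<lambda>u. exp (snd u)"])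
  show "smooth_on UNIV (exp_chart m)"
    using smooth_on_exp_plane[of UNIV m 0 "(snd m, 0)" 0] by (simp add: exp_chart_def)
  show "(exp_chart m has_derivative
      (\<lambda>v. (fst v * exp (fst u)) *\<^sub>R m + (snd v * exp (snd u)) *\<^sub>R (snd m, 0))) (at u)" for u
    using has_derivative_exp_plane[of m 0 "(snd m, 0)" 0 u]
    by (simp add: exp_chart_def case_prod_unfold)
qed (simp_all add: exp_chart_def case_prod_unfold)

text \<open>The inverse is explicit: projecting the second component to \<open>p\<close> recovers
  \<open>exp s\<close>, and projecting the remainder of the first component to \<open>p\<close>
  recovers \<open>t\<close>.\<close>

lemma homeomorphic_map_leaf_chart:
  assumes m: "m \<in> se3_reg"
  shows "homeomorphic_map euclidean (top_of_set (range (leaf_chart m))) (leaf_chart m)"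
proof -
  obtain x p where xp: "m = (x, p)" "p \<noteq> 0" using m by (auto simp: se3_reg_def)
  define a where "a q = (snd q \<bullet> p) / (p \<bullet> p)" for q :: se3
  define chart_inv where "chart_inv q = (ln (a q), ((fst q - a q *\<^sub>R x) \<bullet> p) / (p \<bullet> p))" for q :: se3
  have a: "a (leaf_chart m u) = exp (fst u)" for u
    using xp by (simp add: a_def leaf_chart_def case_prod_unfold)
  have "chart_inv (leaf_chart m u) = u" for u
    using xp(2) by (simp add: chart_inv_def a prod_eq_iff) (simp add: xp leaf_chart_def case_prod_unfold)
  moreover have "continuous_on (range (leaf_chart m)) chart_inv"
  proof -
    have "continuous_on (range (leaf_chart m)) a"
      using xp(2) unfolding a_def by (intro continuous_intros) auto
    moreover have "\<forall>q\<in>range (leaf_chart m). a q \<noteq> 0" using a by auto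
    ultimately show ?thesis
      using xp(2) unfolding chart_inv_def by (intro continuous_intros) auto
  qed
  moreover have "continuous_on UNIV (leaf_chart m)"
    unfolding leaf_chart_def case_prod_unfold by (intro continuous_intros)
  ultimately have "homeomorphic_maps euclidean (top_of_set (range (leaf_chart m))) (leaf_chart m) chart_inv"
    by (auto simp: homeomorphic_maps_def continuous_map_in_subtopology)
  then show ?thesis using homeomorphic_map_maps by blast
qed

text \<open>A single global chart suffices, and as it is a homeomorphism onto its range, the
  subspace topology serves as manifold topology.\<close>

lemma integral_submanifold_leaf:
  assumes D: "\<And>q. q \<in> se3_reg \<Longrightarrow> D q = span {q, (snd q, 0)}" and m: "m \<in> se3_reg"
  shows "integral_submanifold se3_reg D (top_of_set (range (leaf_chart m)))"
  unfolding integral_submanifold_def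
proof (intro conjI ballI)
  let ?L = "range (leaf_chart m)"
  show "topspace (top_of_set ?L) \<subseteq> se3_reg"
    using m by (auto simp: leaf_chart_def se3_reg_def)
  show "Hausdorff_space (top_of_set ?L)"
    by (simp add: Hausdorff_space_subtopology)
  obtain B :: "se3 set set" where "countable B" and B: "topological_basis B"
    using ex_countable_basis by blast
  have "second_countable (euclidean :: se3 topology)"
    unfolding second_countable_def
  proof (intro exI[of _ B] conjI allI impI ballI)
    show "openin euclidean V" if "V \<in> B" for V
      using topological_basis_open[OF B that] by simp
    show "\<exists>V\<in>B. q \<in> V \<and> V \<subseteq> W" if "openin euclidean W \<and> q \<in> W" for W q
      using that by (auto elim: topological_basisE[OF B])
  qed fact
  then show "second_countable (top_of_set ?L)"
    by (rule second_countable_subtopology)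
  fix q assume "q \<in> topspace (top_of_set ?L)"
  then show "\<exists>U V \<phi>. open U \<and> openin (top_of_set ?L) V \<and> q \<in> V \<and>
      homeomorphic_map (top_of_set U) (subtopology (top_of_set ?L) V) \<phi> \<and> integral_immersion D U \<phi>"
    using homeomorphic_map_leaf_chart[OF m] integral_immersion_leaf_chart[OF D m]
    by (intro exI[of _ UNIV] exI[of _ ?L] exI[of _ "leaf_chart m"]) (auto simp: subtopology_subtopology)
qed

text \<open>A complete set of first integrals: the direction of \<open>p\<close> and the component of \<open>x\<close> orthogonal
  to \<open>p\<close> relative to \<open>|p|\<close>, encoded by a cross product. Both are homogeneous of degree 0 and
  invariant under \<open>x \<mapsto> x + t p\<close>.\<close>

definition leaf_invariant :: "se3 \<Rightarrow> (real^3) \<times> (real^3)" where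
  "leaf_invariant q = (snd q /\<^sub>R norm (snd q), cross3 (snd q) (fst q) /\<^sub>R (snd q \<bullet> snd q))"

lemma leaf_invariant_plane:
  assumes "m \<in> se3_reg" "a > 0"
  shows "leaf_invariant (a *\<^sub>R m + b *\<^sub>R (snd m, 0)) = leaf_invariant m"
  using assms
  by (auto simp: leaf_invariant_def se3_reg_def cross_mult_left cross_mult_right cross_add_right field_simps)

text \<open>Completeness of the invariants: equal directions give \<open>r = l *\<^sub>R p\<close>
  with \<open>l > 0\<close>, and equal cross products then make \<open>y - l *\<^sub>R x\<close>
  parallel to \<open>p\<close>. The coordinates are \<open>ln l\<close> and the factor of this
  parallel.\<close>

lemma range_leaf_chart:
  assumes m: "m \<in> se3_reg"
  shows "range (leaf_chart m) = {q \<in> se3_reg. leaf_invariant q = leaf_invariant m}"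
proof (intro equalityI subsetI)
  fix q assume "q \<in> range (leaf_chart m)"
  then obtain s t where "q = exp s *\<^sub>R m + t *\<^sub>R (snd m, 0)" by (auto simp: leaf_chart_def)
  then show "q \<in> {q \<in> se3_reg. leaf_invariant q = leaf_invariant m}"
    using m leaf_invariant_plane[OF m, of "exp s" t] by (auto simp: se3_reg_def)
next
  fix q assume q: "q \<in> {q \<in> se3_reg. leaf_invariant q = leaf_invariant m}"
  obtain x p where xp: "m = (x, p)" "p \<noteq> 0" using m by (auto simp: se3_reg_def)
  obtain y r where yr: "q = (y, r)" "r \<noteq> 0" using q by (auto simp: se3_reg_def)
  define l where "l = norm r / norm p"
  have "l > 0" using xp yr by (simp add: l_def)
  have dir: "r /\<^sub>R norm r = p /\<^sub>R norm p"
    and *: "cross3 r y /\<^sub>R (r \<bullet> r) = cross3 p x /\<^sub>R (p \<bullet> p)"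
    using q by (simp_all add: leaf_invariant_def xp yr)
  have r: "r = l *\<^sub>R p"
  proof -
    have "r = norm r *\<^sub>R (r /\<^sub>R norm r)" using yr by simp
    also have "\<dots> = l *\<^sub>R p"
      unfolding dir by (simp add: l_def divide_inverse)
    finally show ?thesis .
  qed
  from * have "(1 / (l * (p \<bullet> p))) *\<^sub>R cross3 p y = (1 / (p \<bullet> p)) *\<^sub>R cross3 p x"
    using \<open>l > 0\<close> by (simp add: r cross_mult_left field_simps)
  then have "(l * (p \<bullet> p)) *\<^sub>R ((1 / (l * (p \<bullet> p))) *\<^sub>R cross3 p y)
      = (l * (p \<bullet> p)) *\<^sub>R ((1 / (p \<bullet> p)) *\<^sub>R cross3 p x)" by simp
  then have "cross3 p y = l *\<^sub>R cross3 p x" using \<open>l > 0\<close> xp(2) by simp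
  then have "cross3 p (y - l *\<^sub>R x) = 0"
    by (simp add: Cross3.right_diff_distrib cross_mult_right)
  then obtain t where "y - l *\<^sub>R x = t *\<^sub>R p" using cross_eq_0_imp_scaleR xp(2) by blast
  then have "q = leaf_chart m (ln l, t)"
    using \<open>l > 0\<close> by (simp add: leaf_chart_def xp yr r algebra_simps)
  then show "q \<in> range (leaf_chart m)" by blast
qed

text \<open>The derivative is not computed. It exists by the product rules, and it vanishes along
  the span because the map is constant on short line segments in these directions.\<close>

lemma has_derivative_leaf_invariant:
  assumes q: "q \<in> se3_reg"
  shows "\<exists>F'. (leaf_invariant has_derivative F') (at q) \<and> (\<forall>v\<in>span {q, (snd q, 0)}. F' v = 0)"
proof -
  have q0: "snd q \<noteq> 0" using q by (auto simp: se3_reg_def)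
  note snd' = has_derivative_snd[OF has_derivative_ident[of "at q"]]
    and fst' = has_derivative_fst[OF has_derivative_ident[of "at q"]]
  have "(\<lambda>q. norm (snd q)) differentiable (at q)"
    using has_derivative_compose[OF snd' has_derivative_norm[OF q0]] differentiable_def by blast
  then have "(\<lambda>q. inverse (norm (snd q))) differentiable (at q)"
    using q0 by (intro differentiable_inverse) simp_all
  then obtain N' where N': "((\<lambda>q. inverse (norm (snd q))) has_derivative N') (at q)"
    unfolding differentiable_def by blast
  have "(\<lambda>q. snd q \<bullet> snd q) differentiable (at q)"
    using has_derivative_inner[OF snd' snd'] differentiable_def by blast
  then have "(\<lambda>q. inverse (snd q \<bullet> snd q)) differentiable (at q)"
    using q0 by (intro differentiable_inverse) simp_all
  then obtain I' where I': "((\<lambda>q. inverse (snd q \<bullet> snd q)) has_derivative I') (at q)"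
    unfolding differentiable_def by blast
  note cross' = bounded_bilinear.FDERIV[OF bounded_bilinear_cross3 snd' fst']
  have "leaf_invariant differentiable (at q)"
    unfolding leaf_invariant_def[abs_def]
    by (rule differentiableI[OF has_derivative_Pair[OF has_derivative_scaleR[OF N' snd']
          has_derivative_scaleR[OF I' cross']]])
  then obtain F' where F': "(leaf_invariant has_derivative F') (at q)"
    unfolding differentiable_def by blast
  have "F' (c *\<^sub>R q + d *\<^sub>R (snd q, 0)) = 0" for c d
  proof -
    let ?v = "c *\<^sub>R q + d *\<^sub>R (snd q, 0)"
    have line: "((\<lambda>t. q + t *\<^sub>R ?v) has_derivative (\<lambda>t. t *\<^sub>R ?v)) (at 0)"
      by (auto intro!: derivative_eq_intros)
    have "((\<lambda>t. leaf_invariant (q + t *\<^sub>R ?v)) has_derivative (\<lambda>t. F' (t *\<^sub>R ?v))) (at 0)"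
      using has_derivative_compose[OF line, of leaf_invariant F'] F' by simp
    moreover have "((\<lambda>t. leaf_invariant (q + t *\<^sub>R ?v)) has_derivative (\<lambda>t. 0)) (at 0)"
    proof (rule has_derivative_transform_within_open)
      \<comment> \<open>On these parameters the line keeps a positive coefficient of
        \<open>q\<close>, as \<open>leaf_invariant_plane\<close> demands.\<close>
      show "open {t. 1 + t * c > 0}" by (intro open_Collect_less continuous_intros)
      show "leaf_invariant q = leaf_invariant (q + t *\<^sub>R ?v)" if "t \<in> {t. 1 + t * c > 0}" for t
      proof -
        have "q + t *\<^sub>R ?v = (1 + t * c) *\<^sub>R q + (t * d) *\<^sub>R (snd q, 0)"
          by (simp add: prod_eq_iff algebra_simps)
        then show ?thesis using leaf_invariant_plane[OF q, of "1 + t * c" "t * d"] that by simp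
      qed
      show "((\<lambda>t. leaf_invariant q) has_derivative (\<lambda>t. 0)) (at 0)" by simp
    qed simp
    ultimately have "(\<lambda>t. F' (t *\<^sub>R ?v)) = (\<lambda>t. 0)" by (rule has_derivative_unique)
    from fun_cong[OF this, of 1] show ?thesis by simp
  qed
  then show ?thesis using F' unfolding span_pair by blast
qed

section \<open>Maximality and uniqueness of the leaves\<close>

lemma connected_integral_submanifold_subset_leaf:
  assumes D: "\<And>q. q \<in> se3_reg \<Longrightarrow> D q = span {q, (snd q, 0)}" and m: "m \<in> se3_reg"
    and T: "integral_submanifold se3_reg D T" "connected_space T" "m \<in> topspace T"
  shows "topspace T \<subseteq> range (leaf_chart m)"
proof
  fix q assume q: "q \<in> topspace T"
  have "leaf_invariant q = leaf_invariant m"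
  proof (rule first_integral_constant[OF T(1,2) _ T(3) q])
    show "\<exists>F'. (leaf_invariant has_derivative F') (at r) \<and> (\<forall>v\<in>D r. F' v = 0)"
      if "r \<in> se3_reg" for r
      using has_derivative_leaf_invariant[OF that] D[OF that] by simp
  qed
  moreover have "q \<in> se3_reg" using q T(1) unfolding integral_submanifold_def by blast
  ultimately show "q \<in> range (leaf_chart m)" by (simp add: range_leaf_chart[OF m])
qed

text \<open>The equivalence packs existence and uniqueness. Both follow since the leaf is itself
  connected and contains every connected integral submanifold through \<open>m\<close>.\<close>

lemma maximal_integral_submanifold_leaf:
  assumes D: "\<And>q. q \<in> se3_reg \<Longrightarrow> D q = span {q, (snd q, 0)}" and m: "m \<in> se3_reg"
  shows "maximal_integral_submanifold se3_reg D L \<and> m \<in> L \<longleftrightarrow> L = range (leaf_chart m)"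
proof -
  let ?L = "range (leaf_chart m)"
  have mL: "m \<in> ?L" using leaf_chart_0 by (metis rangeI)
  have sub: "topspace T \<subseteq> ?L"
    if "integral_submanifold se3_reg D T" "connected_space T" "m \<in> topspace T" for T
    using D m that by (rule connected_integral_submanifold_subset_leaf)
  have "continuous_on UNIV (leaf_chart m)"
    unfolding leaf_chart_def case_prod_unfold by (intro continuous_intros)
  then have conn: "connected_space (top_of_set ?L)"
    using connected_continuous_image[OF _ connected_UNIV] connectedin_iff_connected
    unfolding connectedin_def by blast
  have int: "integral_submanifold se3_reg D (top_of_set ?L)"
    using D m by (rule integral_submanifold_leaf)
  have "maximal_integral_submanifold se3_reg D ?L"
    unfolding maximal_integral_submanifold_def
  proof (intro conjI allI impI)
    show "\<exists>T. integral_submanifold se3_reg D T \<and> connected_space T \<and> topspace T = ?L"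
      using int conn by (intro exI[of _ "top_of_set ?L"]) simp
    show "topspace T = ?L"
      if "integral_submanifold se3_reg D T \<and> connected_space T \<and> ?L \<subseteq> topspace T" for T
      using sub[of T] that mL by blast
  qed
  moreover have "L = ?L" if L: "maximal_integral_submanifold se3_reg D L" "m \<in> L"
  proof -
    obtain T where T: "integral_submanifold se3_reg D T" "connected_space T" "topspace T = L"
      using L(1) unfolding maximal_integral_submanifold_def by blast
    then have "L \<subseteq> topspace (top_of_set ?L)" using sub[OF T(1,2)] L(2) by simp
    \<comment> \<open>Maximality of \<open>L\<close> is applied to the leaf as the larger connected
      integral submanifold.\<close>
    then show ?thesis
      using L(1) int conn unfolding maximal_integral_submanifold_def by (metis topspace_euclidean_subtopology)
  qed
  ultimately show ?thesis using mL by blast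
qed

lemma integrable_distribution2_se3:
  assumes D: "\<And>q. q \<in> se3_reg \<Longrightarrow> D q = span {q, (snd q, 0)}"
  shows "integrable_distribution2 se3_reg D"
  unfolding integrable_distribution2_def
proof (intro conjI ballI smooth_distribution2_se3 D)
  fix m assume m: "m \<in> se3_reg"
  then show "\<exists>T. integral_submanifold se3_reg D T \<and> m \<in> topspace T"
    using integral_submanifold_leaf[OF D m] leaf_chart_0
    by (metis rangeI topspace_euclidean_subtopology)
qed

section \<open>Comparison of the two parametrizations\<close>

lemma range_exp_chart: "range (exp_chart m) = leaf_chart m ` {(s, t). 0 < t}"
proof (intro equalityI subsetI)
  fix q assume "q \<in> range (exp_chart m)"
  then obtain s t where "q = leaf_chart m (s, exp t)" by (auto simp: exp_chart_def leaf_chart_def)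
  then show "q \<in> leaf_chart m ` {(s, t). 0 < t}" by auto
next
  fix q assume "q \<in> leaf_chart m ` {(s, t). 0 < t}"
  then obtain s t where "0 < t" "q = exp_chart m (s, ln t)"
    by (auto simp: exp_chart_def leaf_chart_def)
  then show "q \<in> range (exp_chart m)" by blast
qed

lemma parametrizes_leaf_chart:
  assumes D: "\<And>q. q \<in> se3_reg \<Longrightarrow> D q = span {q, (snd q, 0)}" and m: "m \<in> se3_reg"
  shows "parametrizes D (leaf_chart m) (range (leaf_chart m))"
    and "parametrizes D (exp_chart m) (leaf_chart m ` {(s, t). 0 < t})"
proof -
  have inj: "inj (leaf_chart m)"
    using homeomorphic_imp_injective_map[OF homeomorphic_map_leaf_chart[OF m]] by simp
  have "exp_chart m = leaf_chart m \<circ> (\<lambda>(s, t). (s, exp t))"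
    by (auto simp: exp_chart_def leaf_chart_def)
  moreover have "inj (\<lambda>(s::real, t::real). (s, exp t))" by (auto simp: inj_def)
  ultimately have "inj (exp_chart m)" using inj by (simp add: inj_compose)
  then show "parametrizes D (leaf_chart m) (range (leaf_chart m))"
    "parametrizes D (exp_chart m) (leaf_chart m ` {(s, t). 0 < t})"
    using inj integral_immersion_leaf_chart[OF D m] integral_immersion_exp_chart[OF D m]
    by (simp_all add: parametrizes_def range_exp_chart)
qed

text \<open>The range is the image of an open half plane under the homeomorphism
  \<open>leaf_chart m\<close>.\<close>

lemma openin_range_exp_chart:
  assumes m: "m \<in> se3_reg"
  shows "openin (top_of_set (range (leaf_chart m))) (range (exp_chart m))"
proof -
  have "{(s::real, t::real). 0 < t} = {u. 0 < snd u}" by auto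
  then have "open {(s::real, t::real). 0 < t}"
    by (auto intro!: open_Collect_less continuous_intros)
  then show ?thesis
    using homeomorphic_imp_open_map[OF homeomorphic_map_leaf_chart[OF m]]
    unfolding range_exp_chart open_map_def by simp
qed

section \<open>The maximal integral submanifolds\<close>

text \<open>The map \<phi> with \<open>exp t\<close> sweeps out only the open part of the leaf with
  positive coefficient of \<open>(p, 0)\<close>, which misses the point \<open>(x, p)\<close>. The
  whole leaf is therefore described by \<psi>, in which \<open>t\<close> replaces
  \<open>exp t\<close>.\<close>

theorem proposition3:
  shows "(\<forall>g. constant_metric g \<and> ad_invariant g \<longrightarrow>
            integrable_distribution2 se3_reg (normal_distribution g)) \<and>
         (\<forall>\<alpha> \<beta> x p. \<alpha> = 0 \<and> \<beta> \<noteq> 0 \<and> (x, p) \<in> se3_reg \<longrightarrow>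
            (let g = block_form (\<alpha> *\<^sub>R mat 1) (\<beta> *\<^sub>R mat 1) (\<beta> *\<^sub>R mat 1) 0;
                 N = normal_distribution g;
                 \<phi> = (\<lambda>(s, t). exp s *\<^sub>R (x, p) + exp t *\<^sub>R (p, 0));
                 \<psi> = (\<lambda>(s, t). exp s *\<^sub>R (x, p) + t *\<^sub>R (p, 0))
             in \<exists>L. maximal_integral_submanifold se3_reg N L \<and> (x, p) \<in> L \<and>
                    (\<forall>L'. maximal_integral_submanifold se3_reg N L' \<and> (x, p) \<in> L' \<longrightarrow> L' = L) \<and>
                    parametrizes N \<psi> L \<and>
                    parametrizes N \<phi> (\<psi> ` {(s, t). 0 < t}) \<and>
                    openin (top_of_set L) (range \<phi>)))"
proof (intro conjI allI impI)
  fix g assume "constant_metric g \<and> ad_invariant g"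
  then show "integrable_distribution2 se3_reg (normal_distribution g)"
    by (intro integrable_distribution2_se3 normal_distribution_eq) auto
next
  fix \<alpha> \<beta> :: real and x p :: "real^3"
  assume asm: "\<alpha> = 0 \<and> \<beta> \<noteq> 0 \<and> (x, p) \<in> se3_reg"
  let ?g = "block_form (\<alpha> *\<^sub>R mat 1) (\<beta> *\<^sub>R mat 1) (\<beta> *\<^sub>R mat 1) 0"
  let ?N = "normal_distribution ?g"
  have m: "(x, p) \<in> se3_reg" using asm by simp
  have D: "?N q = span {q, (snd q, 0)}" if "q \<in> se3_reg" for q
    using asm that by (intro normal_distribution_eq block_form_metric) auto
  have charts: "(\<lambda>(s, t). exp s *\<^sub>R (x, p) + t *\<^sub>R (p, 0)) = leaf_chart (x, p)"
    "(\<lambda>(s, t). exp s *\<^sub>R (x, p) + exp t *\<^sub>R (p, 0)) = exp_chart (x, p)"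
    unfolding leaf_chart_def exp_chart_def snd_conv by (rule refl)+
  have max: "maximal_integral_submanifold se3_reg ?N L \<and> (x, p) \<in> L \<longleftrightarrow>
      L = range (leaf_chart (x, p))" for L
    using D m by (rule maximal_integral_submanifold_leaf)
  have par: "parametrizes ?N (leaf_chart (x, p)) (range (leaf_chart (x, p)))"
    using D m by (rule parametrizes_leaf_chart(1))
  have par': "parametrizes ?N (exp_chart (x, p)) (leaf_chart (x, p) ` {(s, t). 0 < t})"
    using D m by (rule parametrizes_leaf_chart(2))
  show "let g = ?g;
            N = normal_distribution g;
            \<phi> = (\<lambda>(s, t). exp s *\<^sub>R (x, p) + exp t *\<^sub>R (p, 0));
            \<psi> = (\<lambda>(s, t). exp s *\<^sub>R (x, p) + t *\<^sub>R (p, 0))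
        in \<exists>L. maximal_integral_submanifold se3_reg N L \<and> (x, p) \<in> L \<and>
               (\<forall>L'. maximal_integral_submanifold se3_reg N L' \<and> (x, p) \<in> L' \<longrightarrow> L' = L) \<and>
               parametrizes N \<psi> L \<and>
               parametrizes N \<phi> (\<psi> ` {(s, t). 0 < t}) \<and>
               openin (top_of_set L) (range \<phi>)"
    unfolding Let_def charts
    using max par par' openin_range_exp_chart[OF m]
    by (intro exI[of _ "range (leaf_chart (x, p))"]) blast
qed

end
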